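(* Let $\Omega\subseteq\mathbb{R}^n$ be a nonempty closed convex set. Let $J$ be continuously differentiable and strongly convex on $\Omega$ with parameter $\mu>0$, and let $\nabla J$ be Lipschitz continuous on $\Omega$ with constant $L\ge\mu$. Let $\{\tau_k\}_{k=0}^\infty$ be positive scalars with $0<\inf_k\tau_k\le\tau_k\le\sup_k\tau_k<2/L$, let $\{e^k\}_{k=0}^\infty\subset\mathbb{R}^n$ satisfy $\sum_{k=0}^\infty\|e^k\|<+\infty$, and let $\{x^k\}_{k=0}^\infty$ be any sequence with $x^0\in\Omega$ generated by $$x^{k+1}=P_\Omega\big(x^k-\tau_kD(x^k)\nabla J(x^k)+e^k\big),\qquad k\ge0,$$ where the $D(x^k)$ are diagonal $n\times n$ scaling matrices such that $\theta^k:=\nabla J(x^k)-D(x^k)\nabla J(x^k)$ satisfies $\sum_{k=0}^\infty\|\theta^k\|<+\infty$. Then $\{x^k\}_{k=0}^\infty$ converges to a stationary point of the problem of minimizing $J$ over $\Omega$, i.e., to a point of $S$.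
   Context: $\|\cdot\|$ is the Euclidean norm, $\langle\cdot,\cdot\rangle$ the standard inner product, and $P_\Omega$ the orthogonal (Euclidean) projection onto $\Omega$. $J:\Omega\to\mathbb{R}$ has gradient $\nabla J(x)$ defined for $x\in\Omega$ ($J$ is continuously differentiable on an open neighbourhood of $\Omega$). Lipschitz continuity of $\nabla J$ with constant $L$ on $\Omega$: $\|\nabla J(x)-\nabla J(y)\|\le L\|x-y\|$ for all $x,y\in\Omega$. Strong convexity with parameter $\mu$ on $\Omega$: $J(y)\ge J(x)+\langle\nabla J(x),y-x\rangle+\frac12\mu\|y-x\|^2$ for all $x,y\in\Omega$. The residual function is $r(x):=x-P_\Omega(x-\nabla J(x))$ and the set of stationary points is $S:=\{x: r(x)=0\}$ (such points necessarily lie in $\Omega$). Standing assumptions: $S\ne\emptyset$, the problem of minimizing $J$ over $\Omega$ has a solution, and $J^*:=\inf_{x\in\Omega}J(x)$. The diagonal scaling matrices are real diagonal $n\times n$ matrices, $D(x^k)$ possibly depending on $x^k$. *)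

theory Defs
  imports "HOL-Analysis.Analysis"
begin

(* Only meaningful where J is differentiable; there the D below is unique. *)
definition grad :: "(real ^ 'n \<Rightarrow> real) \<Rightarrow> real ^ 'n \<Rightarrow> real ^ 'n" where
  "grad J x = (THE D. GDERIV J x :> D)"

(* C^1 on some open neighbourhood of the set; J is a total function, but its values
   outside that neighbourhood are irrelevant. *)
definition continuously_differentiable_on ::
    "(real ^ 'n \<Rightarrow> real) \<Rightarrow> (real ^ 'n) set \<Rightarrow> bool" where
  "continuously_differentiable_on J \<Omega> \<longleftrightarrow>
     (\<exists>U. open U \<and> \<Omega> \<subseteq> U \<and> (\<forall>x\<in>U. GDERIV J x :> grad J x) \<and> continuous_on U (grad J))"

definition strongly_convex_on ::
    "real \<Rightarrow> (real ^ 'n \<Rightarrow> real) \<Rightarrow> (real ^ 'n) set \<Rightarrow> bool" where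
  "strongly_convex_on \<mu> J \<Omega> \<longleftrightarrow>
     (\<forall>x\<in>\<Omega>. \<forall>y\<in>\<Omega>. J y \<ge> J x + grad J x \<bullet> (y - x) + 1/2 * \<mu> * (norm (y - x))\<^sup>2)"

(* closest_point is the Euclidean projection when the set is nonempty, closed and convex. *)
definition residual ::
    "(real ^ 'n) set \<Rightarrow> (real ^ 'n \<Rightarrow> real) \<Rightarrow> real ^ 'n \<Rightarrow> real ^ 'n" where
  "residual \<Omega> J x = x - closest_point \<Omega> (x - grad J x)"

(* For nonempty closed \<Omega> every zero of the residual is a value of the projection, so it lies
   in \<Omega>; values of grad J outside \<Omega> therefore contribute no points. *)
definition stationary_points :: "(real ^ 'n) set \<Rightarrow> (real ^ 'n \<Rightarrow> real) \<Rightarrow> (real ^ 'n) set" where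
  "stationary_points \<Omega> J = {x. residual \<Omega> J x = 0}"

definition diagonal_matrix :: "real ^ 'n ^ 'n \<Rightarrow> bool" where
  "diagonal_matrix A \<longleftrightarrow> (\<forall>i j. i \<noteq> j \<longrightarrow> A $ i $ j = 0)"

end

theory Submission
  imports Defs
begin

text \<open>
  The scheme is read as a projected gradient step with a vanishing perturbation:
  \<open>x (Suc k)\<close> is the projection of \<open>x k - \<tau> k *\<^sub>R grad J (x k) + w k\<close> with
  \<open>w k = \<tau> k *\<^sub>R \<theta> k + e k\<close>, so that \<open>norm (w k)\<close> is summable.

  Put \<open>d k = x (Suc k) - x k\<close>. Testing the variational inequality of the projection with
  \<open>x k\<close>, and bounding \<open>J\<close> by its quadratic upper model (\<open>descent_lemma\<close>), shows that \<open>J\<close>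
  decreases by a fixed positive multiple of \<open>(norm (d k))\<^sup>2\<close>, up to an error of order
  \<open>(norm (w k))\<^sup>2\<close> (\<open>perturbed_step_decrease\<close>); a positive multiple
  independent of \<open>k\<close> exists because the supremum of the step sizes lies below
  \<open>2 / L\<close>. The errors are summable and \<open>J\<close> is bounded below on the set by its
  value at a stationary point \<open>p\<close>, hence \<open>\<Sum>k. (norm (d k))\<^sup>2\<close> converges and \<open>d\<close> tends to
  zero. Testing the variational inequality with \<open>p\<close> instead, strong monotonicity of the
  gradient bounds \<open>norm (x (Suc k) - p)\<close> by a constant multiple of
  \<open>norm (d k) + norm (w k)\<close> (\<open>perturbed_step_error_bound\<close>), so the iterates converge to \<open>p\<close>.
\<close>

section \<open>Projected gradient steps with a perturbation\<close>

text \<open>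
  Along the segment from \<open>x\<close> to \<open>y\<close> the difference between \<open>J\<close> and the quadratic model
  has derivative \<open>(g z - g x) \<bullet> (y - x) - L * t * (norm (y - x))\<^sup>2\<close> at
  \<open>z = x + t *\<^sub>R (y - x)\<close>, which the Lipschitz bound makes nonpositive; \<open>z\<close> stays in
  \<open>S\<close> by convexity, so the bound applies to it.
\<close>
lemma descent_lemma:
  fixes J :: "'a::real_inner \<Rightarrow> real" and g :: "'a \<Rightarrow> 'a"
  assumes "convex S" and lip: "L-lipschitz_on S g"
    and deriv: "\<And>z. z \<in> S \<Longrightarrow> GDERIV J z :> g z"
    and x: "x \<in> S" and y: "y \<in> S"
  shows "J y \<le> J x + g x \<bullet> (y - x) + L / 2 * (norm (y - x))\<^sup>2"
proof -
  define d where "d = y - x"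
  define \<phi> where "\<phi> = (\<lambda>t. J (x + t *\<^sub>R d) - t * (g x \<bullet> d) - L / 2 * t\<^sup>2 * (norm d)\<^sup>2)"
  have "\<phi> 1 \<le> \<phi> 0"
  proof (rule DERIV_nonpos_imp_nonincreasing[of 0 1 \<phi>])
    fix t :: real assume t: "0 \<le> t" "t \<le> 1"
    define z where "z = x + t *\<^sub>R d"
    have z: "z \<in> S"
      using convexD_alt[OF \<open>convex S\<close> x y t] unfolding z_def d_def by (simp add: algebra_simps)
    have "((\<lambda>t. J (x + t *\<^sub>R d)) has_derivative (\<lambda>s. (s *\<^sub>R d) \<bullet> g z)) (at t)"
    proof (rule has_derivative_compose[where f = "\<lambda>t. x + t *\<^sub>R d"])
      show "((\<lambda>t. x + t *\<^sub>R d) has_derivative (\<lambda>s. s *\<^sub>R d)) (at t)"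
        by (auto intro!: derivative_eq_intros)
      show "(J has_derivative (\<lambda>h. h \<bullet> g z)) (at (x + t *\<^sub>R d))"
        using deriv[OF z] by (simp add: gderiv_def z_def)
    qed
    moreover have "(\<lambda>s. (s *\<^sub>R d) \<bullet> g z) = (*) (g z \<bullet> d)"
      by (simp add: fun_eq_iff inner_commute)
    ultimately have "((\<lambda>t. J (x + t *\<^sub>R d)) has_real_derivative g z \<bullet> d) (at t)"
      by (simp add: has_field_derivative_def)
    then have \<phi>': "(\<phi> has_real_derivative (g z \<bullet> d - g x \<bullet> d - L * t * (norm d)\<^sup>2)) (at t)"
      unfolding \<phi>_def by (auto intro!: derivative_eq_intros)
    have "(g z - g x) \<bullet> d \<le> norm (g z - g x) * norm d"
      by (rule norm_cauchy_schwarz)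
    also have "\<dots> \<le> (L * norm (z - x)) * norm d"
      using lipschitz_onD[OF lip z x] by (intro mult_right_mono) (auto simp: dist_norm)
    also have "\<dots> = L * t * (norm d)\<^sup>2"
      using t by (simp add: z_def power2_eq_square)
    finally have "g z \<bullet> d - g x \<bullet> d - L * t * (norm d)\<^sup>2 \<le> 0"
      by (simp add: inner_diff_left)
    with \<phi>' show "\<exists>y. (\<phi> has_real_derivative y) (at t) \<and> y \<le> 0"
      by blast
  qed simp
  then show ?thesis
    by (simp add: \<phi>_def d_def)
qed

text \<open>
  The decrease of the quadratic model at the projected point is at least
  \<open>c * (norm d)\<^sup>2\<close> minus the cross term \<open>norm w * norm d / \<tau>\<close>. Half of the quadratic term
  absorbs the cross term by Young's inequality, which leaves an error of second order in
  \<open>w\<close>.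
\<close>
lemma perturbed_step_decrease:
  fixes J :: "'a::euclidean_space \<Rightarrow> real" and g :: "'a \<Rightarrow> 'a"
  assumes "closed S" and "convex S" and lip: "L-lipschitz_on S g"
    and deriv: "\<And>z. z \<in> S \<Longrightarrow> GDERIV J z :> g z"
    and x: "x \<in> S" and m: "0 < m" "m \<le> \<tau>"
    and c: "0 < c" "c \<le> 1 / \<tau> - L / 2"
    and y: "y = closest_point S (x - \<tau> *\<^sub>R g x + w)"
  shows "J y \<le> J x - c / 2 * (norm (y - x))\<^sup>2 + (norm w)\<^sup>2 / (2 * c * m\<^sup>2)"
proof -
  define d where "d = y - x"
  have "y \<in> S"
    using x \<open>closed S\<close> y by (auto intro: closest_point_in_set)
  have \<tau>: "0 < \<tau>" using m by linarith
  have "(x - \<tau> *\<^sub>R g x + w - y) \<bullet> (x - y) \<le> 0"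
    unfolding y by (rule closest_point_dot[OF \<open>convex S\<close> \<open>closed S\<close> x])
  moreover have "(x - \<tau> *\<^sub>R g x + w - y) \<bullet> (x - y) = \<tau> * (g x \<bullet> d) + (norm d)\<^sup>2 - w \<bullet> d"
    by (simp add: d_def power2_norm_eq_inner inner_diff_left inner_diff_right
        inner_add_left algebra_simps inner_commute)
  ultimately have "\<tau> * (g x \<bullet> d) \<le> w \<bullet> d - (norm d)\<^sup>2"
    by linarith
  then have model: "g x \<bullet> d \<le> (w \<bullet> d) / \<tau> - (norm d)\<^sup>2 / \<tau>"
    using \<tau> by (simp add: field_simps)
  have "(w \<bullet> d) / \<tau> \<le> norm w * norm d / m"
    using m \<tau> norm_cauchy_schwarz[of w d] by (intro frac_le) auto
  also have "\<dots> \<le> c / 2 * (norm d)\<^sup>2 + (norm w)\<^sup>2 / (2 * c * m\<^sup>2)"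
  proof -
    have "0 \<le> (c * norm d - norm w / m)\<^sup>2 / (2 * c)"
      using c by simp
    also have "\<dots> = c / 2 * (norm d)\<^sup>2 + (norm w)\<^sup>2 / (2 * c * m\<^sup>2) - norm w * norm d / m"
      using c m by (simp add: power2_eq_square field_simps)
    finally show ?thesis by simp
  qed
  finally have cross: "(w \<bullet> d) / \<tau> \<le> c / 2 * (norm d)\<^sup>2 + (norm w)\<^sup>2 / (2 * c * m\<^sup>2)" .
  have "c * (norm d)\<^sup>2 \<le> (1 / \<tau> - L / 2) * (norm d)\<^sup>2"
    using c by (intro mult_right_mono) auto
  then have "c * (norm d)\<^sup>2 \<le> (norm d)\<^sup>2 / \<tau> - L / 2 * (norm d)\<^sup>2"
    by (simp add: left_diff_distrib)
  with descent_lemma[OF \<open>convex S\<close> lip deriv x \<open>y \<in> S\<close>] model cross show ?thesis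
    by (simp add: d_def)
qed

text \<open>
  Adding the variational inequality of the projection, tested with \<open>p\<close>, to the
  first-order condition at \<open>p\<close> bounds \<open>\<tau> * ((g y - g p) \<bullet> (y - p))\<close> by a multiple of
  \<open>norm (y - p)\<close> whose factor is small with the step and the perturbation; replacing
  \<open>g x\<close> by \<open>g y\<close> costs the term \<open>\<tau> * L * norm (y - x)\<close>. Strong monotonicity makes the left side
  quadratic in \<open>norm (y - p)\<close>.
\<close>
lemma perturbed_step_error_bound:
  fixes g :: "'a::euclidean_space \<Rightarrow> 'a"
  assumes "closed S" and "convex S" and lip: "L-lipschitz_on S g"
    and mono: "\<And>u v. u \<in> S \<Longrightarrow> v \<in> S \<Longrightarrow> \<mu> * (norm (u - v))\<^sup>2 \<le> (g u - g v) \<bullet> (u - v)"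
    and "0 < \<mu>" and x: "x \<in> S" and p: "p \<in> S"
    and opt: "\<And>v. v \<in> S \<Longrightarrow> 0 \<le> g p \<bullet> (v - p)"
    and m: "0 < m" "m \<le> \<tau>" and "\<tau> \<le> T"
    and y: "y = closest_point S (x - \<tau> *\<^sub>R g x + w)"
  shows "norm (y - p) \<le> ((1 + T * L) * norm (y - x) + norm w) / (m * \<mu>)"
proof (cases "y = p")
  case True
  have "0 \<le> L" using lip by (rule lipschitz_on_nonneg)
  then show ?thesis
    using True m \<open>\<tau> \<le> T\<close> \<open>0 < \<mu>\<close> by simp
next
  case False
  define r where "r = norm (y - p)"
  have "0 < r" using False by (simp add: r_def)
  have "0 \<le> L" using lip by (rule lipschitz_on_nonneg)
  have \<tau>: "0 < \<tau>" using m by linarith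
  have "y \<in> S"
    using x \<open>closed S\<close> y by (auto intro: closest_point_in_set)
  have "(x - \<tau> *\<^sub>R g x + w - y) \<bullet> (p - y) \<le> 0"
    unfolding y by (rule closest_point_dot[OF \<open>convex S\<close> \<open>closed S\<close> p])
  moreover have "(x - \<tau> *\<^sub>R g x + w - y) \<bullet> (p - y)
      = \<tau> * (g x \<bullet> (y - p)) - (x - y) \<bullet> (y - p) - w \<bullet> (y - p)"
    by (simp add: inner_diff_left inner_diff_right inner_add_left algebra_simps)
  moreover have "(x - y) \<bullet> (y - p) \<le> norm (y - x) * r" "w \<bullet> (y - p) \<le> norm w * r"
    unfolding r_def norm_minus_commute[of y x] by (rule norm_cauchy_schwarz)+
  ultimately have proj: "\<tau> * (g x \<bullet> (y - p)) \<le> norm (y - x) * r + norm w * r"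
    by linarith
  have "(g y - g x) \<bullet> (y - p) \<le> norm (g y - g x) * r"
    unfolding r_def by (rule norm_cauchy_schwarz)
  also have "\<dots> \<le> L * norm (y - x) * r"
    using lipschitz_onD[OF lip \<open>y \<in> S\<close> x] \<open>0 < r\<close>
    by (intro mult_right_mono) (auto simp: dist_norm)
  finally have "\<tau> * ((g y - g x) \<bullet> (y - p)) \<le> \<tau> * (L * norm (y - x) * r)"
    using \<tau> by (intro mult_left_mono) auto
  also have "\<dots> \<le> T * (L * norm (y - x) * r)"
    using \<open>\<tau> \<le> T\<close> \<open>0 \<le> L\<close> \<open>0 < r\<close> by (intro mult_right_mono) auto
  finally have shift: "\<tau> * ((g y - g x) \<bullet> (y - p)) \<le> T * (L * norm (y - x) * r)" .
  have "m * \<mu> * r * r \<le> \<tau> * (\<mu> * r\<^sup>2)"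
    using m \<open>0 < \<mu>\<close> \<open>0 < r\<close> by (simp add: power2_eq_square mult_right_mono)
  also have "\<dots> \<le> \<tau> * ((g y - g p) \<bullet> (y - p))"
    using mono[OF \<open>y \<in> S\<close> p] \<tau> by (simp add: r_def)
  also have "\<dots> \<le> \<tau> * (g y \<bullet> (y - p))"
    using opt[OF \<open>y \<in> S\<close>] \<tau> by (simp add: inner_diff_left)
  also have "\<dots> = \<tau> * ((g y - g x) \<bullet> (y - p)) + \<tau> * (g x \<bullet> (y - p))"
    by (simp add: inner_diff_left algebra_simps)
  also have "\<dots> \<le> ((1 + T * L) * norm (y - x) + norm w) * r"
    using shift proj by (simp add: algebra_simps)
  finally have "m * \<mu> * r \<le> (1 + T * L) * norm (y - x) + norm w"
    using \<open>0 < r\<close> by simp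
  then show ?thesis
    using m \<open>0 < \<mu>\<close> by (simp add: r_def field_simps)
qed

section \<open>Summability of the decreases\<close>

text \<open>
  Telescoping: the total decrease cannot exceed the initial gap to the lower bound plus
  the sum of the errors.
\<close>
lemma summable_decreases:
  fixes a b c :: "nat \<Rightarrow> real"
  assumes step: "\<And>k. a (Suc k) \<le> a k - b k + c k"
    and low: "\<And>k. l \<le> a k" and "\<And>k. 0 \<le> b k" and "\<And>k. 0 \<le> c k" and "summable c"
  shows "summable b"
proof (rule bounded_imp_summable)
  fix n
  have "a (Suc n) + sum b {..n} \<le> a 0 + sum c {..n}"
  proof (induction n)
    case 0
    then show ?case using step[of 0] by simp
  next
    case (Suc n)
    then show ?case using step[of "Suc n"] by simp
  qed
  moreover have "sum c {..n} \<le> suminf c"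
    using assms by (intro sum_le_suminf) auto
  ultimately show "sum b {..n} \<le> a 0 + suminf c - l"
    using low[of "Suc n"] by linarith
qed (rule assms)

section \<open>Strong convexity and stationarity\<close>

lemma strongly_convex_on_imp_strongly_monotone:
  assumes "strongly_convex_on \<mu> J S" "u \<in> S" "v \<in> S"
  shows "\<mu> * (norm (u - v))\<^sup>2 \<le> (grad J u - grad J v) \<bullet> (u - v)"
proof -
  have "J v \<ge> J u + grad J u \<bullet> (v - u) + 1/2 * \<mu> * (norm (v - u))\<^sup>2"
    "J u \<ge> J v + grad J v \<bullet> (u - v) + 1/2 * \<mu> * (norm (u - v))\<^sup>2"
    using assms unfolding strongly_convex_on_def by blast+
  then show ?thesis
    by (simp add: norm_minus_commute[of v u] inner_diff_left inner_diff_right)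
qed

text \<open>
  A zero of the residual is its own projected gradient step, and the variational
  inequality of that projection is the first-order optimality condition.
\<close>
lemma stationary_point_variational_inequality:
  assumes "closed S" "convex S" "S \<noteq> {}" "p \<in> stationary_points S J"
  shows "p \<in> S" and "\<And>v. v \<in> S \<Longrightarrow> 0 \<le> grad J p \<bullet> (v - p)"
proof -
  have p: "closest_point S (p - grad J p) = p"
    using assms(4) by (simp add: stationary_points_def residual_def)
  show "p \<in> S"
    using closest_point_in_set[OF assms(1,3)] p by metis
  show "0 \<le> grad J p \<bullet> (v - p)" if "v \<in> S" for v
    using closest_point_dot[OF assms(2,1) that, of "p - grad J p"] p by simp
qed

section \<open>Convergence of the iterates\<close>

theorem theorem3p2:
  fixes \<Omega> :: "(real ^ 'n) set"
    and J :: "real ^ 'n \<Rightarrow> real"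
    and \<mu> L :: real
    and \<tau> :: "nat \<Rightarrow> real"
    and e x \<theta> :: "nat \<Rightarrow> real ^ 'n"
    and D :: "real ^ 'n \<Rightarrow> real ^ 'n ^ 'n"
  assumes "\<Omega> \<noteq> {}" and "closed \<Omega>" and "convex \<Omega>"
    and "stationary_points \<Omega> J \<noteq> {}"
    and "\<exists>z\<in>\<Omega>. \<forall>y\<in>\<Omega>. J z \<le> J y"
    and "continuously_differentiable_on J \<Omega>"
    and "\<mu> > 0" and "strongly_convex_on \<mu> J \<Omega>"
    and "L \<ge> \<mu>" and "L-lipschitz_on \<Omega> (grad J)"
    and "\<And>k. \<tau> k > 0"
    and "0 < (INF k. \<tau> k)"
    and "\<And>k. (INF k. \<tau> k) \<le> \<tau> k"
    and "\<And>k. \<tau> k \<le> (SUP k. \<tau> k)"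
    and "(SUP k. \<tau> k) < 2 / L"
    and "summable (\<lambda>k. norm (e k))"
    and "x 0 \<in> \<Omega>"
    and "\<And>k. x (Suc k) = closest_point \<Omega> (x k - \<tau> k *\<^sub>R (D (x k) *v grad J (x k)) + e k)"
    and "\<And>k. diagonal_matrix (D (x k))"
    and "\<And>k. \<theta> k = grad J (x k) - D (x k) *v grad J (x k)"
    and "summable (\<lambda>k. norm (\<theta> k))"
  shows "\<exists>p \<in> stationary_points \<Omega> J. x \<longlonglongrightarrow> p"
proof -
  define w where "w k = \<tau> k *\<^sub>R \<theta> k + e k" for k
  define m where "m = (INF k. \<tau> k)"
  define T where "T = (SUP k. \<tau> k)"
  define c where "c = 1 / T - L / 2"
  have "0 < L" using assms(7,9) by linarith
  have m: "0 < m" "\<And>k. m \<le> \<tau> k"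
    using assms(12,13) by (auto simp: m_def)
  have \<tau>T: "\<And>k. \<tau> k \<le> T" and "T < 2 / L"
    using assms(14,15) by (auto simp: T_def)
  have "0 < T" using assms(11)[of 0] \<tau>T[of 0] by linarith
  have "0 < c"
    using \<open>T < 2 / L\<close> \<open>0 < T\<close> \<open>0 < L\<close> by (simp add: c_def field_simps)
  have c: "c \<le> 1 / \<tau> k - L / 2" for k
    using \<tau>T[of k] assms(11)[of k] by (simp add: c_def frac_le)
  have deriv: "GDERIV J z :> grad J z" if "z \<in> \<Omega>" for z
    using assms(6) that unfolding continuously_differentiable_on_def by blast
  obtain p where p: "p \<in> stationary_points \<Omega> J"
    using assms(4) by blast
  note stat = stationary_point_variational_inequality[OF assms(2,3,1) p]
  have step: "x (Suc k) = closest_point \<Omega> (x k - \<tau> k *\<^sub>R grad J (x k) + w k)" for k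
  proof -
    have "x k - \<tau> k *\<^sub>R (D (x k) *v grad J (x k)) + e k = x k - \<tau> k *\<^sub>R grad J (x k) + w k"
      by (simp add: w_def assms(20) scaleR_diff_right)
    then show ?thesis using assms(18)[of k] by (simp only:)
  qed
  have x: "x k \<in> \<Omega>" for k
    using assms(17) closest_point_in_set[OF assms(2,1)] step by (cases k) auto
  have low: "J p \<le> J (x k)" for k
  proof -
    have "J (x k) \<ge> J p + grad J p \<bullet> (x k - p) + 1/2 * \<mu> * (norm (x k - p))\<^sup>2"
      using assms(8) stat(1) x unfolding strongly_convex_on_def by blast
    moreover have "0 \<le> 1/2 * \<mu> * (norm (x k - p))\<^sup>2"
      using assms(7) by simp
    ultimately show ?thesis
      using stat(2)[OF x[of k]] by linarith
  qed

  have sum_w: "summable (\<lambda>k. norm (w k))"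
  proof (rule summable_comparison_test')
    show "summable (\<lambda>k. T * norm (\<theta> k) + norm (e k))"
      using assms(16,21) by (intro summable_add summable_mult)
    fix k :: nat
    have "norm (w k) \<le> \<tau> k * norm (\<theta> k) + norm (e k)"
      unfolding w_def using norm_triangle_ineq[of "\<tau> k *\<^sub>R \<theta> k" "e k"] assms(11)[of k] by simp
    also have "\<dots> \<le> T * norm (\<theta> k) + norm (e k)"
      using \<tau>T by (intro add_right_mono mult_right_mono) auto
    finally show "norm (norm (w k)) \<le> T * norm (\<theta> k) + norm (e k)" by simp
  qed
  have w0: "(\<lambda>k. norm (w k)) \<longlonglongrightarrow> 0"
    using sum_w by (rule summable_LIMSEQ_zero)
  have sum_w2: "summable (\<lambda>k. (norm (w k))\<^sup>2)"
  proof (rule summable_comparison_test_ev[OF _ sum_w])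
    \<comment> \<open>A summable sequence is eventually below one, where squaring decreases it.\<close>
    have "\<forall>\<^sub>F k in sequentially. norm (w k) < 1"
      using w0 by (rule order_tendstoD) simp
    then show "\<forall>\<^sub>F k in sequentially. norm ((norm (w k))\<^sup>2) \<le> norm (w k)"
      by eventually_elim (simp add: power2_eq_square mult_left_le)
  qed

  have "summable (\<lambda>k. c / 2 * (norm (x (Suc k) - x k))\<^sup>2)"
  proof (rule summable_decreases[where a = "\<lambda>k. J (x k)" and l = "J p"
        and c = "\<lambda>k. (norm (w k))\<^sup>2 / (2 * c * m\<^sup>2)"])
    show "J (x (Suc k)) \<le> J (x k) - c / 2 * (norm (x (Suc k) - x k))\<^sup>2
        + (norm (w k))\<^sup>2 / (2 * c * m\<^sup>2)" for k
      by (rule perturbed_step_decrease[OF assms(2,3,10) deriv x m \<open>0 < c\<close> c step])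
    show "summable (\<lambda>k. (norm (w k))\<^sup>2 / (2 * c * m\<^sup>2))"
      using sum_w2 by (rule summable_divide)
  qed (use low \<open>0 < c\<close> in auto)
  then have "(\<lambda>k. c / 2 * (norm (x (Suc k) - x k))\<^sup>2) \<longlonglongrightarrow> 0"
    by (rule summable_LIMSEQ_zero)
  then have "(\<lambda>k. (norm (x (Suc k) - x k))\<^sup>2) \<longlonglongrightarrow> 0"
    using tendsto_mult_left[of _ 0 sequentially "2 / c"] \<open>0 < c\<close> by fastforce
  then have d0: "(\<lambda>k. norm (x (Suc k) - x k)) \<longlonglongrightarrow> 0"
    using tendsto_real_sqrt by fastforce

  have bound: "norm (x (Suc k) - p)
      \<le> ((1 + T * L) * norm (x (Suc k) - x k) + norm (w k)) / (m * \<mu>)" for k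
    using strongly_convex_on_imp_strongly_monotone[OF assms(8)] stat
    by (intro perturbed_step_error_bound[OF assms(2,3,10) _ assms(7) x _ _ m \<tau>T step]) auto
  have "(\<lambda>k. ((1 + T * L) * norm (x (Suc k) - x k) + norm (w k)) / (m * \<mu>)) \<longlonglongrightarrow> 0"
    by (intro tendsto_divide_zero tendsto_add_zero tendsto_mult_right_zero d0 w0)
  then have "(\<lambda>k. x (Suc k) - p) \<longlonglongrightarrow> 0"
    by (rule Lim_null_comparison[OF always_eventually[OF allI[OF bound]]])
  then have "(\<lambda>k. x (Suc k)) \<longlonglongrightarrow> p"
    by (simp add: LIM_zero_iff)
  then show ?thesis
    using p LIMSEQ_imp_Suc by blast
qed

end
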